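(* Let $\nu\ge 0$, $\rho(x)=1+x^2$, and let $g\in C_\rho^{*}(\mathbb{R}^{+})$. Then $$\lim_{n\to\infty}\left\|T_n(g;\cdot)-g\right\|_\rho=0 .$$
   Context: Fix a real $\nu\ge 0$. For $r\in\mathbb{N}_0$ let $$\gamma_\nu(2r)=\frac{2^{2r}\,r!\,\Gamma(r+\nu+1/2)}{\Gamma(\nu+1/2)},\qquad \gamma_\nu(2r+1)=\frac{2^{2r+1}\,r!\,\Gamma(r+\nu+3/2)}{\Gamma(\nu+1/2)},$$ and $e_\nu(x)=\sum_{r=0}^{\infty}\frac{x^r}{\gamma_\nu(r)}$. For an integer $n\ge 1$, $x\ge 0$ and a continuous function $g$ on $[0,\infty)$ for which the integrals exist finitely, define $$T_n(g;x)=\frac{n-1}{e_\nu(nx)}\sum_{r=1}^{\infty}\binom{n+r-2}{r-1}\frac{(nx)^r}{\gamma_\nu(r)}\int_0^\infty s^{r-1}(1+s)^{-n-r+1}g(s)\,ds+\frac{g(0)}{e_\nu(nx)}.$$ For functions with growth $O(1+x^2)$ the operator is considered for $n>3$. Here $\mathbb{R}^+=[0,\infty)$ and $\rho(x)=1+x^2$. $B_\rho(\mathbb{R}^+)$ is the set of functions $g$ on $[0,\infty)$ with $|g(x)|\le M_g\,\rho(x)$ for all $x\geq 0$, where $M_g$ is a constant depending only on $g$; $C_\rho(\mathbb{R}^+)=C[0,\infty)\cap B_\rho(\mathbb{R}^+)$, with norm $\|g\|_\rho=\sup_{x\ge 0}\frac{|g(x)|}{\rho(x)}$; and $C_\rho^{*}(\mathbb{R}^+)$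 is the set of $g\in C_\rho(\mathbb{R}^+)$ such that $\lim_{x\to\infty}\frac{g(x)}{\rho(x)}$ exists and is a (finite) constant. *)

theory Defs
  imports "HOL-Analysis.Analysis"
begin

definition dunkl_gamma :: "real \<Rightarrow> nat \<Rightarrow> real" where
  "dunkl_gamma \<nu> k =
     (if even k
      then 2 ^ k * fact (k div 2) * Gamma (real (k div 2) + \<nu> + 1/2) / Gamma (\<nu> + 1/2)
      else 2 ^ k * fact (k div 2) * Gamma (real (k div 2) + \<nu> + 3/2) / Gamma (\<nu> + 1/2))"

lemma dunkl_gamma_even:
  "dunkl_gamma \<nu> (2 * r) =
     2 ^ (2 * r) * fact r * Gamma (real r + \<nu> + 1/2) / Gamma (\<nu> + 1/2)"
  by (simp add: dunkl_gamma_def)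

lemma dunkl_gamma_odd:
  "dunkl_gamma \<nu> (2 * r + 1) =
     2 ^ (2 * r + 1) * fact r * Gamma (real r + \<nu> + 3/2) / Gamma (\<nu> + 1/2)"
  by (simp add: dunkl_gamma_def)

definition dunkl_exp :: "real \<Rightarrow> real \<Rightarrow> real" where
  "dunkl_exp \<nu> x = (\<Sum>r. x ^ r / dunkl_gamma \<nu> r)"

text \<open>The summand with index \<open>r\<close>; it is only used for \<open>r \<ge> 1\<close> (and \<open>n \<ge> 1\<close>), where the
  truncated subtractions on \<open>nat\<close> are exact.\<close>

definition dunkl_summand :: "real \<Rightarrow> nat \<Rightarrow> (real \<Rightarrow> real) \<Rightarrow> real \<Rightarrow> nat \<Rightarrow> real" where
  "dunkl_summand \<nu> n g x r =
     real ((n + r - 2) choose (r - 1)) * ((real n * x) ^ r / dunkl_gamma \<nu> r) *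
     (LINT s:{0..}|lborel. s ^ (r - 1) * (1 + s) powi (- int n - int r + 1) * g s)"

text \<open>The series over \<open>r \<ge> 1\<close> is written as a series over all \<open>k\<close> with \<open>r = Suc k\<close>.\<close>

definition dunkl_op :: "real \<Rightarrow> nat \<Rightarrow> (real \<Rightarrow> real) \<Rightarrow> real \<Rightarrow> real" where
  "dunkl_op \<nu> n g x =
     (real n - 1) / dunkl_exp \<nu> (real n * x) * (\<Sum>k. dunkl_summand \<nu> n g x (Suc k))
     + g 0 / dunkl_exp \<nu> (real n * x)"

definition rho :: "real \<Rightarrow> real" where
  "rho x = 1 + x\<^sup>2"

text \<open>Functions on \<open>[0, \<infinity>)\<close> are functions on \<^typ>\<open>real\<close> whose values at negative
  arguments are irrelevant.\<close>

definition B_rho :: "(real \<Rightarrow> real) set" where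
  "B_rho = {g. \<exists>M. \<forall>x\<ge>0. \<bar>g x\<bar> \<le> M * rho x}"

definition C_rho :: "(real \<Rightarrow> real) set" where
  "C_rho = {g. continuous_on {0..} g} \<inter> B_rho"

definition C_rho_star :: "(real \<Rightarrow> real) set" where
  "C_rho_star = {g \<in> C_rho. \<exists>L::real. ((\<lambda>x. g x / rho x) \<longlongrightarrow> L) at_top}"

text \<open>The supremum is taken in \<^typ>\<open>ereal\<close>, so that it is \<open>\<infinity>\<close> (rather than unspecified)
  outside \<^const>\<open>B_rho\<close>; convergence of the norms to \<open>0\<close> thus includes that they are
  eventually finite.\<close>

definition rho_norm :: "(real \<Rightarrow> real) \<Rightarrow> ereal" where
  "rho_norm g = (SUP x\<in>{0..}. ereal (\<bar>g x\<bar> / rho x))"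

end

theory Submission
  imports Defs "HOL-Real_Asymp.Real_Asymp"
begin

text \<open>
  The operator is an average. Put \<open>y = n x\<close>. The numbers \<open>y\<^sup>r / (\<gamma>\<^sub>\<nu>(r) e\<^sub>\<nu>(y))\<close>, \<open>r \<ge> 0\<close>, are a
  probability distribution on the naturals (a Dunkl analogue of the Poisson distribution), and for
  \<open>r \<ge> 1\<close> the integral kernel, together with its binomial coefficient and the factor \<open>n - 1\<close>, is the
  density of the beta prime distribution with parameters \<open>r\<close> and \<open>n - 1\<close>. So \<open>T\<^sub>n(g; x)\<close> is the expected
  value of \<open>g\<close> at a random point \<open>s\<close>: draw \<open>r\<close> from the weights, and then \<open>s\<close> from the beta prime
  distribution, with \<open>s = 0\<close> if \<open>r = 0\<close>.

  Two facts then give the theorem. The first is about the function alone: if \<open>g / \<rho>\<close> has a limit at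
  infinity, then for each \<open>\<epsilon> > 0\<close> there is a \<open>C\<close> with
  \<open>\<bar>g s - g x\<bar> \<le> \<epsilon> \<rho>(x) + C (s - x)\<^sup>2\<close> for all \<open>s, x \<ge> 0\<close> (\<open>C_rho_star_quadratic_modulus\<close>). The second is
  about the operator alone: the expected value of \<open>(s - x)\<^sup>2\<close> is at most \<open>\<delta>\<^sub>n \<rho>(x)\<close> with \<open>\<delta>\<^sub>n \<longlonglongrightarrow> 0\<close>
  (\<open>dunkl_mean_square_distance_le\<close> and \<open>square_distance_rate_tendsto\<close>). Taking expected values in the first
  inequality gives \<open>\<bar>T\<^sub>n(g; x) - g x\<bar> \<le> (\<epsilon> + C \<delta>\<^sub>n) \<rho>(x)\<close> for all \<open>x \<ge> 0\<close> at once (\<open>dunkl_op_bound\<close>).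

  For the second fact, the conditional moments given \<open>r\<close> are beta integrals: \<open>s\<close> has mean \<open>r / (n - 2)\<close>
  and \<open>s\<^sup>2\<close> has mean \<open>r (r + 1) / ((n - 2) (n - 3))\<close>. The moments of \<open>r\<close> come from the recurrence
  \<open>\<gamma>\<^sub>\<nu>(r) = [r] \<gamma>\<^sub>\<nu>(r - 1)\<close>, where the Dunkl number \<open>[r]\<close> is \<open>r\<close> for even and \<open>r + 2 \<nu>\<close> for odd \<open>r\<close>:
  it gives \<open>[r]\<close> the mean \<open>y\<close> and \<open>[r] [r - 1]\<close> the mean \<open>y\<^sup>2\<close>. As \<open>[r]\<close> differs from \<open>r\<close> by at most
  \<open>2 \<nu>\<close>, these determine the moments of \<open>r\<close> closely enough. In the resulting bound the coefficient of \<open>x\<^sup>2\<close> is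
  \<open>n\<^sup>2 / ((n - 2) (n - 3)) - 2 n / (n - 2) + 1 = (n + 6) / ((n - 2) (n - 3))\<close>: the terms that do
  not tend to \<open>0\<close> cancel. The terms linear in \<open>x\<close> have coefficients of order \<open>1 / n\<close> as well.
\<close>

section \<open>The quadratic modulus of continuity in the weighted space\<close>

lemma rho_ge_1: "rho x \<ge> 1"
  by (simp add: rho_def)

lemma rho_bounds: "\<bar>x\<bar> \<le> rho x" "x\<^sup>2 \<le> rho x"
proof -
  have "0 \<le> (\<bar>x\<bar> - 1)\<^sup>2" by simp
  then show "\<bar>x\<bar> \<le> rho x" by (simp add: rho_def power2_eq_square algebra_simps)
qed (simp add: rho_def)

text \<open>
  Write \<open>g = q \<rho>\<close> and split \<open>g s - g x = (q s - q x) \<rho>(x) + q s (\<rho>(s) - \<rho>(x))\<close>. The second term is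
  harmless, because \<open>q\<close> is bounded and \<open>\<rho>\<close> is a quadratic polynomial. In the first term \<open>q s - q x\<close> is small
  if both points are far out (there \<open>q\<close> is close to its limit) or if they are close to each other and one
  of them is in a fixed compact interval (there \<open>q\<close> is uniformly continuous). Otherwise
  \<open>\<bar>s - x\<bar>\<close> is bounded below and \<open>x\<close> exceeds it by at most a constant, so that \<open>(s - x)\<^sup>2\<close> dominates \<open>\<rho>(x)\<close>.
\<close>
lemma C_rho_star_quadratic_modulus:
  assumes "g \<in> C_rho_star" "\<epsilon> > 0"
  obtains C where "C \<ge> 0"
    and "\<And>s x. s \<ge> 0 \<Longrightarrow> x \<ge> 0 \<Longrightarrow> \<bar>g s - g x\<bar> \<le> \<epsilon> * rho x + C * (s - x)\<^sup>2"
proof -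
  obtain M L where cont: "continuous_on {0..} g" and M: "\<And>x. x \<ge> 0 \<Longrightarrow> \<bar>g x\<bar> \<le> M * rho x"
    and L: "((\<lambda>x. g x / rho x) \<longlongrightarrow> L) at_top"
    using assms(1) unfolding C_rho_star_def C_rho_def B_rho_def by blast
  define q where "q x = g x / rho x" for x
  have rho_pos: "rho x > 0" for x using rho_ge_1[of x] by linarith
  have gq: "g x = q x * rho x" for x using rho_pos[of x] by (simp add: q_def)
  have qM: "\<bar>q x\<bar> \<le> M" if "x \<ge> 0" for x
    using M[OF that] rho_pos[of x] by (simp add: q_def abs_divide divide_le_eq)
  have M0: "M \<ge> 0" using qM[of 0] by simp
  have "\<forall>\<^sub>F x in at_top. dist (q x) L < \<epsilon> / 4"
    using tendstoD[OF L, of "\<epsilon> / 4"] assms(2) by (simp add: q_def)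
  then obtain A0 where A0: "\<And>x. x \<ge> A0 \<Longrightarrow> dist (q x) L < \<epsilon> / 4"
    by (auto simp: eventually_at_top_linorder)
  define A where "A = max A0 0"
  have A: "A \<ge> 0" "A \<ge> A0" by (auto simp: A_def)
  \<comment> \<open>If \<open>s < A\<close> or \<open>x < A\<close>, and \<open>\<bar>s - x\<bar> < 1\<close>, then both points lie in \<open>[0, A + 1]\<close>; hence \<open>d \<le> 1\<close> below.\<close>
  have "continuous_on {0..A + 1} q"
    unfolding q_def
    by (intro continuous_on_divide continuous_on_subset[OF cont])
       (auto simp: rho_def add_nonneg_eq_0_iff intro!: continuous_intros)
  then have "uniformly_continuous_on {0..A + 1} q"
    by (rule compact_uniformly_continuous) simp
  moreover have "\<epsilon> / 2 > 0" using assms(2) by simp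
  ultimately obtain d0 where d0: "d0 > 0"
    "\<And>x s. x \<in> {0..A + 1} \<Longrightarrow> s \<in> {0..A + 1} \<Longrightarrow> dist s x < d0 \<Longrightarrow> dist (q s) (q x) < \<epsilon> / 2"
    unfolding uniformly_continuous_on_def by meson
  define d where "d = min d0 1"
  have d: "d > 0" "d \<le> d0" "d \<le> 1" using d0 by (auto simp: d_def)
  \<comment> \<open>\<open>2 M\<close> bounds \<open>\<bar>q s - q x\<bar>\<close>; the other factor comes from \<open>x \<le> A + \<bar>s - x\<bar>\<close> and \<open>1 \<le> (s - x)\<^sup>2 / d\<^sup>2\<close>.\<close>
  define C1 where "C1 = 2 * M * ((1 + 2 * A\<^sup>2) / d\<^sup>2 + 2)"
  define C2 where "C2 = M + 2 * M\<^sup>2 / \<epsilon>"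
  have C_nonneg: "C1 \<ge> 0" "C2 \<ge> 0" using M0 assms(2) by (auto simp: C1_def C2_def)
  have ratio: "\<bar>q s - q x\<bar> * rho x \<le> \<epsilon> / 2 * rho x + C1 * (s - x)\<^sup>2"
    if "s \<ge> 0" "x \<ge> 0" for s x
  proof -
    consider "s \<ge> A" "x \<ge> A" | "s < A \<or> x < A" "\<bar>s - x\<bar> < d" | "s < A \<or> x < A" "\<bar>s - x\<bar> \<ge> d"
      by linarith
    then show ?thesis
    proof cases
      case 3
      have "1 + x\<^sup>2 \<le> (1 + 2 * A\<^sup>2) + 2 * (s - x)\<^sup>2"
      proof -
        have "x \<le> A + \<bar>s - x\<bar>" using 3 d by linarith
        then have "x\<^sup>2 \<le> (A + \<bar>s - x\<bar>)\<^sup>2" using that by (intro power_mono) auto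
        also have "\<dots> \<le> 2 * A\<^sup>2 + 2 * (s - x)\<^sup>2"
          using sum_squares_bound[of A "\<bar>s - x\<bar>"] by (simp add: power2_sum)
        finally show ?thesis by simp
      qed
      moreover have "(1 + 2 * A\<^sup>2) * 1 \<le> (1 + 2 * A\<^sup>2) * ((s - x)\<^sup>2 / d\<^sup>2)"
      proof (rule mult_left_mono)
        have "d\<^sup>2 \<le> \<bar>s - x\<bar>\<^sup>2" using 3 d by (intro power_mono) auto
        then show "1 \<le> (s - x)\<^sup>2 / d\<^sup>2" using d by simp
      qed simp
      ultimately have "rho x \<le> ((1 + 2 * A\<^sup>2) / d\<^sup>2 + 2) * (s - x)\<^sup>2"
        by (simp add: rho_def algebra_simps)
      then have "2 * M * rho x \<le> 2 * M * (((1 + 2 * A\<^sup>2) / d\<^sup>2 + 2) * (s - x)\<^sup>2)"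
        using M0 by (intro mult_left_mono) auto
      moreover have "\<bar>q s - q x\<bar> * rho x \<le> 2 * M * rho x"
        using qM[of s] qM[of x] that rho_pos[of x] by (intro mult_right_mono) auto
      moreover have "0 \<le> \<epsilon> / 2 * rho x" using assms(2) rho_pos[of x] by simp
      ultimately show ?thesis unfolding C1_def by (simp only: mult.assoc)
    next
      case 1
      then have "\<bar>q s - L\<bar> < \<epsilon> / 4" "\<bar>q x - L\<bar> < \<epsilon> / 4"
        using A0[of s] A0[of x] A by (auto simp: dist_real_def)
      then have "\<bar>q s - q x\<bar> \<le> \<epsilon> / 2" by linarith
      then have "\<bar>q s - q x\<bar> * rho x \<le> \<epsilon> / 2 * rho x"
        using rho_pos[of x] by (intro mult_right_mono) auto
      also have "\<dots> \<le> \<epsilon> / 2 * rho x + C1 * (s - x)\<^sup>2" using C_nonneg by simp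
      finally show ?thesis .
    next
      case 2
      then have "dist (q s) (q x) < \<epsilon> / 2"
        using that d by (intro d0(2)) (auto simp: dist_real_def)
      then have "\<bar>q s - q x\<bar> * rho x \<le> \<epsilon> / 2 * rho x"
        using rho_pos[of x] by (intro mult_right_mono) (auto simp: dist_real_def)
      also have "\<dots> \<le> \<epsilon> / 2 * rho x + C1 * (s - x)\<^sup>2" using C_nonneg by simp
      finally show ?thesis .
    qed
  qed
  have weight: "M * \<bar>rho s - rho x\<bar> \<le> \<epsilon> / 2 * rho x + C2 * (s - x)\<^sup>2" if "x \<ge> 0" for s x
  proof -
    have "\<bar>rho s - rho x\<bar> = \<bar>(s - x)\<^sup>2 + 2 * x * (s - x)\<bar>"
      by (simp add: rho_def power2_eq_square algebra_simps)
    also have "\<dots> \<le> (s - x)\<^sup>2 + 2 * x * \<bar>s - x\<bar>"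
      using that abs_triangle_ineq[of "(s - x)\<^sup>2" "2 * x * (s - x)"] by (simp add: abs_mult)
    finally have "M * \<bar>rho s - rho x\<bar> \<le> M * ((s - x)\<^sup>2 + 2 * x * \<bar>s - x\<bar>)"
      using M0 by (rule mult_left_mono)
    \<comment> \<open>Young's inequality, with the square weighted so that \<open>x\<^sup>2\<close> gets the coefficient \<open>\<epsilon> / 2\<close>.\<close>
    moreover have "2 * x * M * \<bar>s - x\<bar> \<le> \<epsilon> / 2 * x\<^sup>2 + 2 * M\<^sup>2 / \<epsilon> * (s - x)\<^sup>2"
    proof -
      have "0 \<le> (\<epsilon> * x - 2 * M * \<bar>s - x\<bar>)\<^sup>2 / (2 * \<epsilon>)" using assms(2) by simp
      also have "\<dots> = \<epsilon> / 2 * x\<^sup>2 + 2 * M\<^sup>2 / \<epsilon> * \<bar>s - x\<bar>\<^sup>2 - 2 * x * M * \<bar>s - x\<bar>"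
        using assms(2) by (simp only: power2_diff) (simp add: field_simps power2_eq_square)
      finally show ?thesis by simp
    qed
    moreover have "\<epsilon> / 2 * x\<^sup>2 \<le> \<epsilon> / 2 * rho x"
      using assms(2) rho_bounds(2)[of x] by (intro mult_left_mono) auto
    ultimately show ?thesis by (simp add: C2_def algebra_simps)
  qed
  show ?thesis
  proof (rule that)
    show "C1 + C2 \<ge> 0" using C_nonneg by simp
    fix s x :: real assume sx: "s \<ge> 0" "x \<ge> 0"
    have "g s - g x = (q s - q x) * rho x + q s * (rho s - rho x)"
      by (simp add: gq algebra_simps)
    then have "\<bar>g s - g x\<bar> \<le> \<bar>q s - q x\<bar> * rho x + \<bar>q s\<bar> * \<bar>rho s - rho x\<bar>"
      using abs_triangle_ineq[of "(q s - q x) * rho x" "q s * (rho s - rho x)"] rho_pos[of x]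
      by (simp add: abs_mult)
    also have "\<dots> \<le> \<bar>q s - q x\<bar> * rho x + M * \<bar>rho s - rho x\<bar>"
      using qM[OF sx(1)] by (intro add_left_mono mult_right_mono) auto
    also have "\<dots> \<le> \<epsilon> * rho x + (C1 + C2) * (s - x)\<^sup>2"
      using ratio[OF sx] weight[OF sx(2), of s] by (simp add: algebra_simps)
    finally show "\<bar>g s - g x\<bar> \<le> \<epsilon> * rho x + (C1 + C2) * (s - x)\<^sup>2" .
  qed
qed

section \<open>The Dunkl analogue of the Poisson distribution\<close>

definition dunkl_number :: "real \<Rightarrow> nat \<Rightarrow> real" where
  "dunkl_number \<nu> r = real r + (if odd r then 2 * \<nu> else 0)"

lemma dunkl_gamma_0:
  assumes "\<nu> \<ge> 0"
  shows "dunkl_gamma \<nu> 0 = 1"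
proof -
  have "Gamma (\<nu> + 1/2) > 0"
    using assms by (intro Gamma_real_pos) auto
  then show ?thesis
    by (simp add: dunkl_gamma_def)
qed

text \<open>
  In both parities one factor of the Gamma quotient or of the factorial is split off: \<open>\<gamma>\<^sub>\<nu>\<close> is the
  factorial built from the Dunkl numbers.
\<close>
lemma dunkl_gamma_Suc:
  assumes "\<nu> \<ge> 0"
  shows "dunkl_gamma \<nu> (Suc r) = dunkl_number \<nu> (Suc r) * dunkl_gamma \<nu> r"
proof (cases "even r")
  case True
  then obtain j where r: "r = 2 * j" by (elim evenE)
  have "real j + \<nu> + 1/2 \<notin> \<int>\<^sub>\<le>\<^sub>0"
    using assms by (auto elim!: nonpos_Ints_cases)
  from Gamma_plus1[OF this]
  have "Gamma (real j + \<nu> + 3/2) = (real j + \<nu> + 1/2) * Gamma (real j + \<nu> + 1/2)"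
    by (simp add: add.assoc)
  then show ?thesis
    unfolding r Suc_eq_plus1 dunkl_gamma_odd dunkl_gamma_even
    by (simp add: dunkl_number_def divide_simps) (simp add: algebra_simps)
next
  case False
  then obtain j where r: "r = 2 * j + 1" by (elim oddE)
  have "dunkl_gamma \<nu> (Suc r) = dunkl_gamma \<nu> (2 * (j + 1))"
    by (simp add: r)
  also have "\<dots> = 2 ^ (2 * (j + 1)) * fact (j + 1) * Gamma (real j + \<nu> + 3/2) / Gamma (\<nu> + 1/2)"
    by (subst dunkl_gamma_even) (simp add: algebra_simps)
  also have "\<dots> = dunkl_number \<nu> (Suc r) * dunkl_gamma \<nu> r"
    unfolding r dunkl_gamma_odd by (simp add: dunkl_number_def divide_simps)
  finally show ?thesis .
qed

lemma dunkl_gamma_ge_fact: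
  assumes "\<nu> \<ge> 0"
  shows "fact r \<le> dunkl_gamma \<nu> r"
proof (induction r)
  case 0
  then show ?case by (simp add: dunkl_gamma_0 assms)
next
  case (Suc r)
  have "fact (Suc r) = real (Suc r) * fact r" by simp
  also have "\<dots> \<le> dunkl_number \<nu> (Suc r) * dunkl_gamma \<nu> r"
    using assms by (intro mult_mono Suc) (auto simp: dunkl_number_def)
  finally show ?case by (simp only: dunkl_gamma_Suc[OF assms])
qed

lemma dunkl_gamma_pos:
  assumes "\<nu> \<ge> 0"
  shows "dunkl_gamma \<nu> r > 0"
  using dunkl_gamma_ge_fact[OF assms, of r] fact_gt_zero[of r, where 'a = real] by linarith

lemma dunkl_exp_sums:
  assumes "\<nu> \<ge> 0" "y \<ge> 0"
  shows "(\<lambda>r. y ^ r / dunkl_gamma \<nu> r) sums dunkl_exp \<nu> y"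
proof -
  have "summable (\<lambda>r. y ^ r / dunkl_gamma \<nu> r)"
  proof (rule summable_comparison_test')
    show "summable (\<lambda>r. inverse (fact r) * y ^ r)" by (rule summable_exp)
    fix r :: nat
    have "y ^ r / dunkl_gamma \<nu> r \<le> y ^ r / fact r"
      using dunkl_gamma_pos[OF assms(1), of r] dunkl_gamma_ge_fact[OF assms(1), of r] assms(2)
      by (intro divide_left_mono) auto
    then show "norm (y ^ r / dunkl_gamma \<nu> r) \<le> inverse (fact r) * y ^ r"
      using dunkl_gamma_pos[OF assms(1), of r] assms(2) by (simp add: field_simps)
  qed
  then show ?thesis
    unfolding dunkl_exp_def by (rule summable_sums)
qed

lemma dunkl_exp_ge_1:
  assumes "\<nu> \<ge> 0" "y \<ge> 0"
  shows "dunkl_exp \<nu> y \<ge> 1"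
proof -
  have "(\<Sum>r\<in>{0}. y ^ r / dunkl_gamma \<nu> r) \<le> dunkl_exp \<nu> y"
    using dunkl_exp_sums[OF assms] assms less_imp_le[OF dunkl_gamma_pos[OF assms(1)]]
    by (intro sums_le[OF _ sums_If_finite_set[of "{0}" "\<lambda>r. y ^ r / dunkl_gamma \<nu> r"]]) auto
  then show ?thesis by (simp add: dunkl_gamma_0 assms)
qed

definition dunkl_weight :: "real \<Rightarrow> real \<Rightarrow> nat \<Rightarrow> real" where
  "dunkl_weight \<nu> y r = y ^ r / dunkl_gamma \<nu> r / dunkl_exp \<nu> y"

lemma dunkl_weight_nonneg:
  assumes "\<nu> \<ge> 0" "y \<ge> 0"
  shows "dunkl_weight \<nu> y r \<ge> 0"
  using dunkl_gamma_pos[OF assms(1), of r] dunkl_exp_ge_1[OF assms] assms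
  by (simp add: dunkl_weight_def)

lemma dunkl_weight_sums_1:
  assumes "\<nu> \<ge> 0" "y \<ge> 0"
  shows "dunkl_weight \<nu> y sums 1"
  using sums_divide[OF dunkl_exp_sums[OF assms], of "dunkl_exp \<nu> y"] dunkl_exp_ge_1[OF assms]
  by (simp add: dunkl_weight_def[abs_def])

text \<open>
  The size-biasing identity of the Poisson distribution: a factor \<open>[r]\<close> shifts the weights by one place,
  so each further factor \<open>[r], [r - 1], \<dots>\<close> contributes a factor \<open>y\<close> to the expected value.
\<close>
lemma dunkl_number_weight_Suc:
  assumes "\<nu> \<ge> 0"
  shows "dunkl_number \<nu> (Suc r) * dunkl_weight \<nu> y (Suc r) = y * dunkl_weight \<nu> y r"
proof -
  have "dunkl_number \<nu> (Suc r) > 0"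
    using assms by (simp add: dunkl_number_def add_pos_nonneg)
  then show ?thesis
    using dunkl_gamma_pos[OF assms, of r]
    by (simp add: dunkl_weight_def dunkl_gamma_Suc[OF assms])
qed

lemma dunkl_weight_first_moment:
  assumes "\<nu> \<ge> 0" "y \<ge> 0"
  shows "(\<lambda>r. dunkl_number \<nu> r * dunkl_weight \<nu> y r) sums y"
proof (rule sums_Suc_imp)
  show "(\<lambda>r. dunkl_number \<nu> (Suc r) * dunkl_weight \<nu> y (Suc r)) sums y"
    using sums_mult[OF dunkl_weight_sums_1[OF assms], of y]
    by (simp add: dunkl_number_weight_Suc assms)
qed (simp add: dunkl_number_def)

lemma dunkl_weight_second_moment:
  assumes "\<nu> \<ge> 0" "y \<ge> 0"
  shows "(\<lambda>r. dunkl_number \<nu> r * dunkl_number \<nu> (r - 1) * dunkl_weight \<nu> y r) sums y\<^sup>2"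
proof (rule sums_Suc_imp)
  have "dunkl_number \<nu> (Suc r) * dunkl_number \<nu> (Suc r - 1) * dunkl_weight \<nu> y (Suc r)
      = y * (dunkl_number \<nu> r * dunkl_weight \<nu> y r)" for r
    using arg_cong[OF dunkl_number_weight_Suc[OF assms(1), of r y], of "\<lambda>u. dunkl_number \<nu> r * u"]
    by (simp add: mult_ac)
  then show "(\<lambda>r. dunkl_number \<nu> (Suc r) * dunkl_number \<nu> (Suc r - 1)
      * dunkl_weight \<nu> y (Suc r)) sums y\<^sup>2"
    using sums_mult[OF dunkl_weight_first_moment[OF assms], of y]
    by (simp only: power2_eq_square)
qed (simp add: dunkl_number_def)

section \<open>The beta prime distribution\<close>

text \<open>
  The beta integral \<open>B(k + 1, d + 1)\<close> on the half-line. As \<open>s = (1 + s) - 1\<close>, the integrand for \<open>Suc k\<close> is a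
  difference of two integrands for \<open>k\<close>, so integrability and value follow together by induction from the
  elementary case \<open>k = 0\<close>.
\<close>
lemma beta_prime_integral:
  shows "set_integrable lborel {0..} (\<lambda>s::real. s ^ k / (1 + s) ^ (k + d + 2))"
    and "(LINT s:{0..}|lborel. s ^ k / (1 + s) ^ (k + d + 2)) =
           fact k * fact d / (fact (k + d + 1) :: real)"
proof -
  have "set_integrable lborel {0..} (\<lambda>s::real. s ^ k / (1 + s) ^ (k + d + 2)) \<and>
    (LINT s:{0..}|lborel. s ^ k / (1 + s) ^ (k + d + 2)) = fact k * fact d / (fact (k + d + 1) :: real)"
  proof (induction k arbitrary: d)
    case 0
    \<comment> \<open>The antiderivative that vanishes at infinity.\<close>
    let ?F = "\<lambda>s::real. - 1 / (real (d + 1) * (1 + s) ^ (d + 1))"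
    have "(\<integral>\<^sup>+s. ennreal (1 / (1 + s) ^ (d + 2)) * indicator {0..} s \<partial>lborel) = ennreal (0 - ?F 0)"
    proof (rule nn_integral_FTC_atLeast)
      show "DERIV ?F s :> 1 / (1 + s) ^ (d + 2)" if "0 \<le> s" for s
      proof -
        have nz: "(1 + s) ^ d \<noteq> 0" "1 + s \<noteq> 0" "real (d + 1) \<noteq> 0" using that by auto
        have "DERIV (\<lambda>s. (1 + s) ^ (d + 1)) s :> real (d + 1) * (1 + s) ^ d"
          using DERIV_power[OF DERIV_add[OF DERIV_const DERIV_ident], of 1 "d + 1" s] by simp
        then have "DERIV (\<lambda>s. (- 1 / real (d + 1)) * inverse ((1 + s) ^ (d + 1))) s :>
            (- 1 / real (d + 1)) * - (inverse ((1 + s) ^ (d + 1)) * (real (d + 1) * (1 + s) ^ d)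
              * inverse ((1 + s) ^ (d + 1)))"
          using nz by (intro DERIV_cmult DERIV_inverse') auto
        moreover have "c \<noteq> 0 \<Longrightarrow> p \<noteq> 0 \<Longrightarrow> q \<noteq> 0 \<Longrightarrow>
            (- 1 / c) * - (inverse (p * q) * (c * p) * inverse (p * q)) = 1 / (p * (q * q))" for c p q :: real
          by (simp add: divide_simps)
        from this[OF nz(3,1,2)] have "(- 1 / real (d + 1)) * - (inverse ((1 + s) ^ (d + 1))
            * (real (d + 1) * (1 + s) ^ d) * inverse ((1 + s) ^ (d + 1))) = 1 / (1 + s) ^ (d + 2)"
          by (simp only: power_add power_one_right power2_eq_square)
        moreover have "?F = (\<lambda>s. (- 1 / real (d + 1)) * inverse ((1 + s) ^ (d + 1)))"
          by (simp add: fun_eq_iff divide_inverse)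
        ultimately show ?thesis by simp
      qed
      have "filterlim (\<lambda>s::real. (1 + s) ^ (d + 1)) at_top at_top"
        by (intro filterlim_pow_at_top filterlim_tendsto_add_at_top[OF tendsto_const] filterlim_ident) simp
      then have "filterlim (\<lambda>s::real. real (d + 1) * (1 + s) ^ (d + 1)) at_infinity at_top"
        by (intro filterlim_at_top_imp_at_infinity filterlim_tendsto_pos_mult_at_top[OF tendsto_const]) auto
      then show "(?F \<longlongrightarrow> 0) at_top"
        by (rule tendsto_divide_0[OF tendsto_const])
    qed auto
    moreover have "(\<integral>\<^sup>+s. ennreal (1 / (1 + s) ^ (d + 2)) * indicator {0..} s \<partial>lborel)
        = (\<integral>\<^sup>+s. ennreal (indicator {0..} s *\<^sub>R (1 / (1 + s) ^ (d + 2))) \<partial>lborel)"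
      by (intro nn_integral_cong) (auto split: split_indicator)
    ultimately have "(\<integral>\<^sup>+s. ennreal (indicator {0..} s *\<^sub>R (1 / (1 + s) ^ (d + 2))) \<partial>lborel)
        = ennreal (1 / real (d + 1))"
      by simp
    then have "has_bochner_integral lborel (\<lambda>s. indicator {0..} s *\<^sub>R (1 / (1 + s) ^ (d + 2)))
        (1 / real (d + 1))"
      by (intro has_bochner_integral_nn_integral) (auto intro!: AE_I2 split: split_indicator)
    moreover have "1 / real (d + 1) = fact d / fact (d + 1)"
      by (simp add: divide_simps)
    ultimately show ?case
      by (simp add: has_bochner_integral_iff set_integrable_def set_lebesgue_integral_def)
  next
    case (Suc k)
    let ?f = "\<lambda>d (s::real). s ^ k / (1 + s) ^ (k + d + 2)"
    have split: "s ^ Suc k / (1 + s) ^ (Suc k + d + 2) = ?f d s - ?f (Suc d) s" if "s \<in> {0..}" for s :: real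
    proof -
      have "1 + s > 0" using that by simp
      then show ?thesis by (simp add: divide_simps) (simp add: algebra_simps)
    qed
    note IH = Suc.IH[THEN conjunct1] Suc.IH[THEN conjunct2]
    have "set_integrable lborel {0..} (\<lambda>s. ?f d s - ?f (Suc d) s)"
      by (intro set_integral_diff(1) IH(1))
    moreover have "set_integrable lborel {0..} (\<lambda>s::real. s ^ Suc k / (1 + s) ^ (Suc k + d + 2))
        = set_integrable lborel {0..} (\<lambda>s. ?f d s - ?f (Suc d) s)"
      by (rule set_integrable_cong[OF refl refl]) (use split in blast)
    ultimately have int: "set_integrable lborel {0..} (\<lambda>s::real. s ^ Suc k / (1 + s) ^ (Suc k + d + 2))"
      by (simp only:)
    have "(LINT s:{0..}|lborel. s ^ Suc k / (1 + s) ^ (Suc k + d + 2))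
        = (LINT s:{0..}|lborel. ?f d s - ?f (Suc d) s)"
      by (rule set_lebesgue_integral_cong) (simp, use split in blast)
    also have "\<dots> = fact k * fact d / fact (k + d + 1) - fact k * fact (Suc d) / fact (k + Suc d + 1)"
      by (subst set_integral_diff(2)[OF IH(1)[of d] IH(1)[of "Suc d"]]) (simp only: IH(2))
    also have "\<dots> = fact (Suc k) * fact d / fact (Suc k + d + 1)"
      by (simp add: divide_simps) (simp add: algebra_simps)
    finally have "(LINT s:{0..}|lborel. s ^ Suc k / (1 + s) ^ (Suc k + d + 2)) =
        fact (Suc k) * fact d / (fact (Suc k + d + 1) :: real)" .
    with int show ?case by blast
  qed
  then show "set_integrable lborel {0..} (\<lambda>s::real. s ^ k / (1 + s) ^ (k + d + 2))"
    "(LINT s:{0..}|lborel. s ^ k / (1 + s) ^ (k + d + 2)) = fact k * fact d / (fact (k + d + 1) :: real)"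
    by blast+
qed

text \<open>
  The density of the beta prime distribution with parameters \<open>r\<close> and \<open>n - 1\<close>, for \<open>n \<ge> 2\<close> and \<open>r \<ge> 1\<close>; the
  constant is \<open>1 / B(r, n - 1)\<close>.
\<close>
definition beta_prime_density :: "nat \<Rightarrow> nat \<Rightarrow> real \<Rightarrow> real" where
  "beta_prime_density n r s =
     fact (n + r - 2) / (fact (r - 1) * fact (n - 2)) * (s ^ (r - 1) / (1 + s) ^ (n + r - 1))"

lemma beta_prime_density_nonneg:
  "s \<ge> 0 \<Longrightarrow> beta_prime_density n r s \<ge> 0"
  by (simp add: beta_prime_density_def)

lemma beta_prime_moment:
  assumes "n \<ge> j + 2" "r \<ge> 1"
  shows "set_integrable lborel {0..} (\<lambda>s. beta_prime_density n r s * s ^ j)"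
    and "(LINT s:{0..}|lborel. beta_prime_density n r s * s ^ j) =
           fact (r + j - 1) * fact (n - j - 2) / (fact (r - 1) * fact (n - 2))"
proof -
  let ?c = "fact (n + r - 2) / (fact (r - 1) * fact (n - 2)) :: real"
  have eq: "beta_prime_density n r s * s ^ j
      = ?c * (s ^ (r + j - 1) / (1 + s) ^ ((r + j - 1) + (n - j - 2) + 2))" for s
  proof -
    have "n + r - 1 = (r + j - 1) + (n - j - 2) + 2" "r + j - 1 = (r - 1) + j" using assms by auto
    moreover from this(2) have "s ^ (r + j - 1) = s ^ (r - 1) * s ^ j"
      by (simp only: power_add)
    ultimately show ?thesis
      unfolding beta_prime_density_def by (simp only: times_divide_eq_left times_divide_eq_right mult.assoc)
  qed
  show "set_integrable lborel {0..} (\<lambda>s. beta_prime_density n r s * s ^ j)"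
    unfolding eq by (intro set_integrable_mult_right beta_prime_integral(1))
  have "n + r - 2 = (r + j - 1) + (n - j - 2) + 1" using assms by auto
  then show "(LINT s:{0..}|lborel. beta_prime_density n r s * s ^ j) =
           fact (r + j - 1) * fact (n - j - 2) / (fact (r - 1) * fact (n - 2))"
    unfolding eq set_integral_mult_right beta_prime_integral(2) by (simp add: divide_simps)
qed

text \<open>
  The expected value of \<open>(s - x)\<^sup>2\<close> under this density, for \<open>n > 3\<close> and \<open>r \<ge> 1\<close>. At \<open>r = 0\<close> the formula gives \<open>x\<^sup>2\<close>, the second moment
  about \<open>x\<close> of the point mass at \<open>0\<close>, which matches the term \<open>g 0\<close> of the operator.
\<close>
definition beta_prime_square_distance :: "nat \<Rightarrow> nat \<Rightarrow> real \<Rightarrow> real" where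
  "beta_prime_square_distance n r x =
     real r * (real r + 1) / ((real n - 2) * (real n - 3)) - 2 * x * (real r / (real n - 2)) + x\<^sup>2"

lemma beta_prime_quadratic:
  assumes "n > 3" "r \<ge> 1"
  shows "set_integrable lborel {0..} (\<lambda>s. beta_prime_density n r s * (a + C * (s - x)\<^sup>2))"
    and "(LINT s:{0..}|lborel. beta_prime_density n r s * (a + C * (s - x)\<^sup>2)) =
           a + C * beta_prime_square_distance n r x"
proof -
  let ?K = "beta_prime_density n r"
  obtain N where n: "n = N + 4" using assms le_Suc_ex[of 4 n] by (auto simp: add.commute)
  obtain k where r: "r = Suc k" using assms by (cases r) auto
  have m0: "set_integrable lborel {0..} ?K" "(LINT s:{0..}|lborel. ?K s) = 1"
    using beta_prime_moment[of 0 n r] assms by auto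
  have m1: "set_integrable lborel {0..} (\<lambda>s. ?K s * s)"
      "(LINT s:{0..}|lborel. ?K s * s) = real r / (real n - 2)"
    using beta_prime_moment[of 1 n r] assms
    by (auto simp: n r divide_simps fact_reduce)
  have m2: "set_integrable lborel {0..} (\<lambda>s. ?K s * s\<^sup>2)"
      "(LINT s:{0..}|lborel. ?K s * s\<^sup>2) = real r * (real r + 1) / ((real n - 2) * (real n - 3))"
    using beta_prime_moment[of 2 n r] assms
    by (auto simp: n r divide_simps fact_reduce)
  have eq: "?K s * (a + C * (s - x)\<^sup>2) = (a + C * x\<^sup>2) * ?K s + (C * (?K s * s\<^sup>2) - 2 * C * x * (?K s * s))" for s
    by (simp add: power2_eq_square algebra_simps)
  note int = set_integrable_mult_right[OF m0(1), of "a + C * x\<^sup>2"]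
    set_integrable_mult_right[OF m2(1), of C] set_integrable_mult_right[OF m1(1), of "2 * C * x"]
  show "set_integrable lborel {0..} (\<lambda>s. ?K s * (a + C * (s - x)\<^sup>2))"
    unfolding eq by (intro set_integral_add(1) set_integral_diff(1) int)
  show "(LINT s:{0..}|lborel. ?K s * (a + C * (s - x)\<^sup>2)) = a + C * beta_prime_square_distance n r x"
    unfolding eq set_integral_add(2)[OF int(1) set_integral_diff(1)[OF int(2,3)]]
      set_integral_diff(2)[OF int(2,3)] set_integral_mult_right m0 m1 m2 beta_prime_square_distance_def
    by (simp add: algebra_simps)
qed

text \<open>
  The density has integral \<open>1\<close>, so integrating the two quadratic functions that enclose \<open>g\<close> encloses the
  integral of \<open>g\<close>. The same quadratic bound also gives the integrability of \<open>g\<close> against the density.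
\<close>
lemma beta_prime_mean_bound:
  assumes "n > 3" "r \<ge> 1" and cont: "continuous_on {0..} g"
    and le: "\<And>s. s \<ge> 0 \<Longrightarrow> \<bar>g s - g x\<bar> \<le> a + C * (s - x)\<^sup>2"
  shows "\<bar>(LINT s:{0..}|lborel. beta_prime_density n r s * g s) - g x\<bar>
    \<le> a + C * beta_prime_square_distance n r x"
proof -
  let ?K = "beta_prime_density n r"
  note quad = beta_prime_quadratic[OF assms(1,2)]
  have int: "set_integrable lborel {0..} (\<lambda>s. ?K s * g s)"
  proof (rule set_integrable_bound)
    show "set_integrable lborel {0..} (\<lambda>s. ?K s * ((\<bar>g x\<bar> + a) + C * (s - x)\<^sup>2))"
      by (rule quad(1))
    have "continuous_on {0..} (\<lambda>s. ?K s * g s)"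
      unfolding beta_prime_density_def by (intro continuous_intros cont) auto
    then have "(\<lambda>s. indicator {0..} s *\<^sub>R (?K s * g s)) \<in> borel_measurable borel"
      by (rule borel_measurable_continuous_on_indicator[rotated]) simp
    then show "set_borel_measurable lborel {0..} (\<lambda>s. ?K s * g s)"
      by (simp add: set_borel_measurable_def)
    show "AE s in lborel. s \<in> {0..} \<longrightarrow> norm (?K s * g s) \<le> norm (?K s * ((\<bar>g x\<bar> + a) + C * (s - x)\<^sup>2))"
    proof (intro AE_I2 impI)
      fix s :: real assume s: "s \<in> {0..}"
      have "\<bar>g s\<bar> \<le> \<bar>(\<bar>g x\<bar> + a) + C * (s - x)\<^sup>2\<bar>" using le[of s] s by auto
      then show "norm (?K s * g s) \<le> norm (?K s * ((\<bar>g x\<bar> + a) + C * (s - x)\<^sup>2))"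
        by (simp add: abs_mult mult_left_mono)
    qed
  qed
  have "(LINT s:{0..}|lborel. ?K s * g s)
      \<le> (LINT s:{0..}|lborel. ?K s * ((g x + a) + C * (s - x)\<^sup>2))"
  proof (rule set_integral_mono[OF int quad(1)])
    fix s :: real assume s: "s \<in> {0..}"
    show "?K s * g s \<le> ?K s * ((g x + a) + C * (s - x)\<^sup>2)"
      using le[of s] s by (intro mult_left_mono beta_prime_density_nonneg) auto
  qed
  moreover have "(LINT s:{0..}|lborel. ?K s * ((g x - a) + (- C) * (s - x)\<^sup>2))
      \<le> (LINT s:{0..}|lborel. ?K s * g s)"
  proof (rule set_integral_mono[OF quad(1) int])
    fix s :: real assume s: "s \<in> {0..}"
    show "?K s * ((g x - a) + (- C) * (s - x)\<^sup>2) \<le> ?K s * g s"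
      using le[of s] s by (intro mult_left_mono beta_prime_density_nonneg) auto
  qed
  ultimately show ?thesis
    unfolding quad(2) by linarith
qed

section \<open>The second moment of the operator\<close>

text \<open>
  The powers of \<open>r\<close> do not have simple moments under the Dunkl weights, so the quadratic polynomial in \<open>r\<close>
  is replaced by a combination of \<open>[r]\<close> and \<open>[r] [r - 1]\<close>, using \<open>r \<le> [r] \<le> r + 2 \<nu>\<close>: the upper
  estimate is applied to the term with the negative sign and the lower one to the others.
\<close>
lemma beta_prime_square_distance_le:
  assumes "\<nu> \<ge> 0" "x \<ge> 0" "n > 3"
  defines "\<alpha> \<equiv> 1 / ((real n - 2) * (real n - 3))" and "\<beta> \<equiv> 1 / (real n - 2)"
  shows "beta_prime_square_distance n r x \<le>
    \<alpha> * (dunkl_number \<nu> r * dunkl_number \<nu> (r - 1)) + (2 * \<alpha> - 2 * x * \<beta>) * dunkl_number \<nu> r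
      + (4 * \<nu> * x * \<beta> + x\<^sup>2)"
proof -
  have nonneg: "\<alpha> \<ge> 0" "\<beta> \<ge> 0" using assms by (auto simp: \<alpha>_def \<beta>_def)
  have le: "real k \<le> dunkl_number \<nu> k" "dunkl_number \<nu> k \<le> real k + 2 * \<nu>" for k
    using assms(1) by (auto simp: dunkl_number_def)
  have "real r * real (r - 1) \<le> dunkl_number \<nu> r * dunkl_number \<nu> (r - 1)"
    by (intro mult_mono le order.trans[OF of_nat_0_le_iff le(1)]) auto
  moreover have "real r * (real r + 1) = real r * real (r - 1) + 2 * real r"
    by (cases r) (auto simp: algebra_simps)
  ultimately have "real r * (real r + 1) \<le> dunkl_number \<nu> r * dunkl_number \<nu> (r - 1) + 2 * dunkl_number \<nu> r"
    using le(1)[of r] by linarith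
  then have "\<alpha> * (real r * (real r + 1)) \<le> \<alpha> * (dunkl_number \<nu> r * dunkl_number \<nu> (r - 1) + 2 * dunkl_number \<nu> r)"
    using nonneg by (intro mult_left_mono) auto
  moreover have "2 * x * \<beta> * (dunkl_number \<nu> r - 2 * \<nu>) \<le> 2 * x * \<beta> * real r"
    using nonneg assms(2) le(2)[of r] by (intro mult_left_mono) auto
  moreover have "beta_prime_square_distance n r x = \<alpha> * (real r * (real r + 1)) - 2 * x * \<beta> * real r + x\<^sup>2"
    by (simp add: beta_prime_square_distance_def \<alpha>_def \<beta>_def)
  ultimately show ?thesis by (simp add: algebra_simps)
qed

definition square_distance_rate :: "real \<Rightarrow> nat \<Rightarrow> real" where
  "square_distance_rate \<nu> n =
     (3 * real n + 6) / ((real n - 2) * (real n - 3)) + 4 * \<nu> / (real n - 2)"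

lemma square_distance_rate_tendsto: "square_distance_rate \<nu> \<longlonglongrightarrow> 0"
  unfolding square_distance_rate_def by real_asymp

text \<open>
  The conditional mean square distance is passed through a majorant \<open>V\<close>, whose mean \<open>S\<close> under the Dunkl
  weights can be computed exactly.
\<close>
lemma dunkl_mean_square_distance_le:
  assumes "\<nu> \<ge> 0" "x \<ge> 0" "n > 3"
  obtains V S where "\<And>r. beta_prime_square_distance n r x \<le> V r"
    and "(\<lambda>r. dunkl_weight \<nu> (real n * x) r * V r) sums S"
    and "S \<le> square_distance_rate \<nu> n * rho x"
proof -
  define \<alpha> \<beta> y where "\<alpha> = 1 / ((real n - 2) * (real n - 3))" and "\<beta> = 1 / (real n - 2)"
    and "y = real n * x"
  define V where "V r = \<alpha> * (dunkl_number \<nu> r * dunkl_number \<nu> (r - 1))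
      + (2 * \<alpha> - 2 * x * \<beta>) * dunkl_number \<nu> r + (4 * \<nu> * x * \<beta> + x\<^sup>2)" for r
  define S where "S = \<alpha> * y\<^sup>2 + (2 * \<alpha> - 2 * x * \<beta>) * y + (4 * \<nu> * x * \<beta> + x\<^sup>2) * 1"
  have y: "y \<ge> 0" using assms by (simp add: y_def)
  have "(\<lambda>r. dunkl_weight \<nu> y r * V r) = (\<lambda>r.
      \<alpha> * (dunkl_number \<nu> r * dunkl_number \<nu> (r - 1) * dunkl_weight \<nu> y r)
      + (2 * \<alpha> - 2 * x * \<beta>) * (dunkl_number \<nu> r * dunkl_weight \<nu> y r)
      + (4 * \<nu> * x * \<beta> + x\<^sup>2) * dunkl_weight \<nu> y r)"
    by (simp add: V_def algebra_simps)
  also have "\<dots> sums S"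
    unfolding S_def
    by (intro sums_add sums_mult dunkl_weight_second_moment dunkl_weight_first_moment
        dunkl_weight_sums_1 assms y)
  finally have sums: "(\<lambda>r. dunkl_weight \<nu> y r * V r) sums S" .
  have n: "real n - 2 > 0" "real n - 3 > 0" using assms(3) by auto
  have "S = (real n + 6) * \<alpha> * x\<^sup>2 + 2 * real n * \<alpha> * x + 4 * \<nu> * \<beta> * x"
  proof -
    \<comment> \<open>Over the common denominator \<open>(n - 2) (n - 3)\<close> the terms \<open>n\<^sup>2 x\<^sup>2\<close> cancel.\<close>
    have "x\<^sup>2 = (real n - 2) * (real n - 3) * \<alpha> * x\<^sup>2" "\<beta> = (real n - 3) * \<alpha>"
      using n by (auto simp: \<alpha>_def \<beta>_def)
    then show ?thesis
      unfolding S_def y_def by (simp add: power2_eq_square) (algebra)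
  qed
  also have "\<dots> \<le> (real n + 6) * \<alpha> * rho x + 2 * real n * \<alpha> * rho x + 4 * \<nu> * \<beta> * rho x"
    using n assms rho_bounds[of x]
    by (intro add_mono mult_left_mono) (auto simp: \<alpha>_def \<beta>_def)
  also have "\<dots> = square_distance_rate \<nu> n * rho x"
    by (simp add: square_distance_rate_def \<alpha>_def \<beta>_def add_divide_distrib algebra_simps)
  finally have "S \<le> square_distance_rate \<nu> n * rho x" .
  moreover have "beta_prime_square_distance n r x \<le> V r" for r
    unfolding V_def \<alpha>_def \<beta>_def by (rule beta_prime_square_distance_le) (use assms in auto)
  ultimately show ?thesis
    using that sums unfolding y_def by blast
qed

section \<open>The operator as an expected value\<close>

text \<open>
  The value at \<open>r = 0\<close> makes the separate term \<open>g 0 / e\<^sub>\<nu>(n x)\<close> of the operator the term \<open>r = 0\<close> of the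
  expected value.
\<close>
definition conditional_mean :: "nat \<Rightarrow> (real \<Rightarrow> real) \<Rightarrow> nat \<Rightarrow> real" where
  "conditional_mean n g r =
     (if r = 0 then g 0 else LINT s:{0..}|lborel. beta_prime_density n r s * g s)"

lemma dunkl_summand_eq:
  assumes "n > 1" "r \<ge> 1"
  shows "(real n - 1) * dunkl_summand \<nu> n g x r =
    (real n * x) ^ r / dunkl_gamma \<nu> r * conditional_mean n g r"
proof -
  have "(fact (n - 1) :: real) = (real n - 1) * fact (n - 2)"
    using assms fact_reduce[of "n - 1", where 'a = real] by (simp add: numeral_2_eq_2)
  moreover have "n + r - 2 - (r - 1) = n - 1"
    using assms by simp
  ultimately have binom: "(real n - 1) * real ((n + r - 2) choose (r - 1))
      = fact (n + r - 2) / (fact (r - 1) * fact (n - 2))"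
    using assms by (subst binomial_fact) auto
  have density: "beta_prime_density n r s * g s = (real n - 1) * real ((n + r - 2) choose (r - 1)) *
      (s ^ (r - 1) * (1 + s) powi (- int n - int r + 1) * g s)" for s
  proof -
    have "- int n - int r + 1 = - int (n + r - 1)"
      using assms by auto
    then have "(1 + s) powi (- int n - int r + 1) = 1 / (1 + s) ^ (n + r - 1)"
      by (simp only: power_int_minus power_int_of_nat inverse_eq_divide)
    then show ?thesis unfolding binom beta_prime_density_def by simp
  qed
  have "conditional_mean n g r = (real n - 1) * real ((n + r - 2) choose (r - 1)) *
      (LINT s:{0..}|lborel. s ^ (r - 1) * (1 + s) powi (- int n - int r + 1) * g s)"
    unfolding set_integral_mult_right[symmetric] density[symmetric]
    using assms by (simp add: conditional_mean_def)
  then show ?thesis by (simp add: dunkl_summand_def)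
qed

lemma dunkl_op_eq_mean:
  assumes "\<nu> \<ge> 0" "x \<ge> 0" "n > 1"
    and S: "(\<lambda>r. dunkl_weight \<nu> (real n * x) r * conditional_mean n g r) sums S"
  shows "dunkl_op \<nu> n g x = S"
proof -
  define e where "e = dunkl_exp \<nu> (real n * x)"
  have e: "e > 0" using dunkl_exp_ge_1[of \<nu> "real n * x"] assms by (simp add: e_def)
  have n: "real n - 1 > 0" using assms by simp
  have "dunkl_weight \<nu> (real n * x) 0 * conditional_mean n g 0 = g 0 / e"
    by (simp add: dunkl_weight_def conditional_mean_def dunkl_gamma_0 assms e_def)
  with S have "(\<lambda>k. dunkl_weight \<nu> (real n * x) (Suc k) * conditional_mean n g (Suc k)) sums (S - g 0 / e)"
    by (subst sums_Suc_iff) simp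
  from sums_mult[OF this, of "e / (real n - 1)"]
  have "(\<lambda>k. dunkl_summand \<nu> n g x (Suc k)) sums (e / (real n - 1) * (S - g 0 / e))"
  proof (rule back_subst[of "\<lambda>f. f sums _"], intro ext)
    fix k
    show "e / (real n - 1) * (dunkl_weight \<nu> (real n * x) (Suc k) * conditional_mean n g (Suc k))
        = dunkl_summand \<nu> n g x (Suc k)"
    proof -
      have "e / (real n - 1) * (dunkl_weight \<nu> (real n * x) (Suc k) * conditional_mean n g (Suc k))
          = (real n * x) ^ Suc k / dunkl_gamma \<nu> (Suc k) * conditional_mean n g (Suc k) / (real n - 1)"
        using e by (simp add: dunkl_weight_def e_def[symmetric] del: power_Suc)
      also have "\<dots> = dunkl_summand \<nu> n g x (Suc k)"
        using dunkl_summand_eq[of n "Suc k" \<nu> g x, symmetric] assms(3) n by (simp del: power_Suc)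
      finally show ?thesis .
    qed
  qed
  then have "(\<Sum>k. dunkl_summand \<nu> n g x (Suc k)) = e / (real n - 1) * (S - g 0 / e)"
    by (rule sums_unique[symmetric])
  then show ?thesis
    using e n by (simp add: dunkl_op_def e_def[symmetric])
qed

text \<open>
  Both expected values, first over \<open>s\<close> and then over \<open>r\<close>, preserve the pointwise inequality. The series
  of the majorants converges, and by comparison this also proves that the series of the operator converges.
\<close>
lemma dunkl_op_bound:
  assumes "\<nu> \<ge> 0" "x \<ge> 0" "n > 3" and cont: "continuous_on {0..} g" and C: "C \<ge> 0"
    and le: "\<And>s. s \<ge> 0 \<Longrightarrow> \<bar>g s - g x\<bar> \<le> a + C * (s - x)\<^sup>2"
  shows "\<bar>dunkl_op \<nu> n g x - g x\<bar> \<le> a + C * (square_distance_rate \<nu> n * rho x)"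
proof -
  let ?w = "dunkl_weight \<nu> (real n * x)" and ?F = "conditional_mean n g"
  have y: "real n * x \<ge> 0" using assms by simp
  obtain V S where V: "\<And>r. beta_prime_square_distance n r x \<le> V r"
    and S: "(\<lambda>r. ?w r * V r) sums S" and Sle: "S \<le> square_distance_rate \<nu> n * rho x"
    using dunkl_mean_square_distance_le[OF assms(1-3)] by blast
  have F: "\<bar>?F r - g x\<bar> \<le> a + C * V r" for r
  proof -
    have "\<bar>?F r - g x\<bar> \<le> a + C * beta_prime_square_distance n r x"
    proof (cases "r = 0")
      case True
      then show ?thesis using le[of 0] by (simp add: conditional_mean_def beta_prime_square_distance_def)
    next
      case False
      then show ?thesis
        using beta_prime_mean_bound[OF assms(3) _ cont le, of r] by (simp add: conditional_mean_def)
    qed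
    also have "\<dots> \<le> a + C * V r" using C V by (intro add_left_mono mult_left_mono)
    finally show ?thesis .
  qed
  have bound: "\<bar>?w r * (?F r - g x)\<bar> \<le> a * ?w r + C * (?w r * V r)" for r
  proof -
    have "\<bar>?w r * (?F r - g x)\<bar> = ?w r * \<bar>?F r - g x\<bar>"
      using dunkl_weight_nonneg[OF assms(1) y, of r] by (simp add: abs_mult)
    also have "\<dots> \<le> ?w r * (a + C * V r)"
      by (intro mult_left_mono F dunkl_weight_nonneg assms y)
    finally show ?thesis by (simp add: algebra_simps)
  qed
  have U: "(\<lambda>r. a * ?w r + C * (?w r * V r)) sums (a * 1 + C * S)"
    by (intro sums_add sums_mult S dunkl_weight_sums_1 assms y)
  have "summable (\<lambda>r. ?w r * (?F r - g x))"
    by (rule summable_comparison_test'[OF sums_summable[OF U]]) (use bound in simp)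
  then obtain T where T: "(\<lambda>r. ?w r * (?F r - g x)) sums T"
    by (auto simp: summable_def)
  have "T \<le> a * 1 + C * S"
    by (rule sums_le[OF _ T U]) (use bound in \<open>simp add: abs_le_iff\<close>)
  moreover have "- T \<le> a * 1 + C * S"
    by (rule sums_le[OF _ sums_minus[OF T] U]) (use bound in \<open>simp add: abs_le_iff\<close>)
  ultimately have Tle: "\<bar>T\<bar> \<le> a + C * S" by linarith
  have "(\<lambda>r. ?w r * ?F r) sums (T + g x * 1)"
    using sums_add[OF T sums_mult[OF dunkl_weight_sums_1[OF assms(1) y], of "g x"]]
    by (simp add: algebra_simps)
  then have "dunkl_op \<nu> n g x = T + g x * 1"
    using assms by (intro dunkl_op_eq_mean) auto
  moreover have "C * S \<le> C * (square_distance_rate \<nu> n * rho x)"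
    using C Sle by (rule mult_left_mono[rotated])
  ultimately show ?thesis using Tle by simp
qed

text \<open>
  The modulus is used with half of the required accuracy; the other half is taken by \<open>C \<delta>\<^sub>n\<close> for large \<open>n\<close>.
  Since \<open>C\<close> is the same for all \<open>x\<close>, the estimate is uniform in the weighted norm.
\<close>
theorem theorem5:
  fixes \<nu> :: real and g :: "real \<Rightarrow> real"
  assumes "\<nu> \<ge> 0"
    and "g \<in> C_rho_star"
  shows "(\<lambda>n. rho_norm (\<lambda>x. dunkl_op \<nu> n g x - g x)) \<longlonglongrightarrow> 0"
proof (rule order_tendstoI)
  fix a :: ereal assume a: "a < 0"
  have "0 \<le> rho_norm f" for f
    unfolding rho_norm_def using rho_ge_1[of 0]
    by (intro SUP_upper2[of 0]) auto
  then show "\<forall>\<^sub>F n in sequentially. a < rho_norm (\<lambda>x. dunkl_op \<nu> n g x - g x)"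
    using a by (intro always_eventually allI) (rule less_le_trans)
next
  fix a :: ereal assume "0 < a"
  then obtain b where b: "0 < ereal b" "ereal b < a" using ereal_dense2 by blast
  then have "b / 2 > 0" by simp
  then obtain C where C: "C \<ge> 0"
    "\<And>s x. s \<ge> 0 \<Longrightarrow> x \<ge> 0 \<Longrightarrow> \<bar>g s - g x\<bar> \<le> b / 2 * rho x + C * (s - x)\<^sup>2"
    using C_rho_star_quadratic_modulus[OF assms(2)] by blast
  have cont: "continuous_on {0..} g" using assms(2) by (simp add: C_rho_star_def C_rho_def)
  have "(\<lambda>n. C * square_distance_rate \<nu> n) \<longlonglongrightarrow> 0"
    by (intro tendsto_mult_right_zero square_distance_rate_tendsto)
  from order_tendstoD(2)[OF this \<open>b / 2 > 0\<close>] eventually_gt_at_top[of 3]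
  show "\<forall>\<^sub>F n in sequentially. rho_norm (\<lambda>x. dunkl_op \<nu> n g x - g x) < a"
  proof eventually_elim
    case (elim n)
    have "rho_norm (\<lambda>x. dunkl_op \<nu> n g x - g x) \<le> ereal b"
      unfolding rho_norm_def
    proof (rule SUP_least)
      fix x :: real assume "x \<in> {0..}"
      then have x: "x \<ge> 0" by simp
      have "\<bar>dunkl_op \<nu> n g x - g x\<bar> \<le> b / 2 * rho x + C * (square_distance_rate \<nu> n * rho x)"
        using x C elim by (intro dunkl_op_bound assms cont) auto
      also have "\<dots> = (b / 2 + C * square_distance_rate \<nu> n) * rho x"
        by (simp add: algebra_simps)
      also have "\<dots> \<le> b * rho x"
        using elim rho_ge_1[of x] by (intro mult_right_mono) auto
      finally show "ereal (\<bar>dunkl_op \<nu> n g x - g x\<bar> / rho x) \<le> ereal b"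
        using rho_ge_1[of x] by (simp add: divide_le_eq)
    qed
    also have "\<dots> < a" by (rule b)
    finally show ?case .
  qed
qed

end
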